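(* Let $R$ be a ring. (a) $R$ is uniquely clean if and only if $R$ is conjugate clean and abelian. (b) $R$ is uniquely nil clean if and only if $R$ is conjugate nil clean and abelian.
   Context: Rings are associative with unity. A ring is abelian if all its idempotents are central. A clean (resp. nil clean) decomposition of $a\in R$ is an equation $a=e+t$ with $e=e^2\in R$ and $t$ a unit (resp. a nilpotent element) of $R$. $R$ is clean (resp. nil clean) if every element has a clean (resp. nil clean) decomposition; it is uniquely clean (resp. uniquely nil clean) if every element has exactly one such decomposition; it is conjugate clean (resp. conjugate nil clean) if it is clean (resp. nil clean) and, whenever $a=e+s=f+t$ are two clean (resp. nil clean) decompositions of the same element $a\in R$ with idempotents $e,f$, the idempotents $e,f$ are conjugate in $R$, i.e. $e=ufu^{-1}$ for some unit $u$ of $R$. *)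

theory Defs
  imports "HOL-Algebra.Ring"
begin

text \<open>
  Rings are rings in the sense of the locale \<^locale>\<open>ring\<close>: associative, with unity, not
  necessarily commutative, and possibly zero.
\<close>

definition idempotents :: "('a, 'm) ring_scheme \<Rightarrow> 'a set"
  where "idempotents R = {e \<in> carrier R. e \<otimes>\<^bsub>R\<^esub> e = e}"

definition nilpotents :: "('a, 'm) ring_scheme \<Rightarrow> 'a set"
  where "nilpotents R = {x \<in> carrier R. \<exists>n::nat. x [^]\<^bsub>R\<^esub> n = \<zero>\<^bsub>R\<^esub>}"

definition ring_center :: "('a, 'm) ring_scheme \<Rightarrow> 'a set"
  where "ring_center R = {z \<in> carrier R. \<forall>x \<in> carrier R. z \<otimes>\<^bsub>R\<^esub> x = x \<otimes>\<^bsub>R\<^esub> z}"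

definition abelian_ring :: "('a, 'm) ring_scheme \<Rightarrow> bool"
  where "abelian_ring R \<longleftrightarrow> ring R \<and> idempotents R \<subseteq> ring_center R"

definition ring_conjugate :: "('a, 'm) ring_scheme \<Rightarrow> 'a \<Rightarrow> 'a \<Rightarrow> bool"
  where "ring_conjugate R e f \<longleftrightarrow> (\<exists>u \<in> Units R. e = u \<otimes>\<^bsub>R\<^esub> f \<otimes>\<^bsub>R\<^esub> inv\<^bsub>R\<^esub> u)"

definition clean_decomp :: "('a, 'm) ring_scheme \<Rightarrow> 'a \<Rightarrow> 'a \<Rightarrow> 'a \<Rightarrow> bool"
  where "clean_decomp R a e t \<longleftrightarrow> e \<in> idempotents R \<and> t \<in> Units R \<and> a = e \<oplus>\<^bsub>R\<^esub> t"

definition nil_clean_decomp :: "('a, 'm) ring_scheme \<Rightarrow> 'a \<Rightarrow> 'a \<Rightarrow> 'a \<Rightarrow> bool"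
  where "nil_clean_decomp R a e t \<longleftrightarrow> e \<in> idempotents R \<and> t \<in> nilpotents R \<and> a = e \<oplus>\<^bsub>R\<^esub> t"

definition clean_ring :: "('a, 'm) ring_scheme \<Rightarrow> bool"
  where "clean_ring R \<longleftrightarrow> ring R \<and> (\<forall>a \<in> carrier R. \<exists>e t. clean_decomp R a e t)"

definition nil_clean_ring :: "('a, 'm) ring_scheme \<Rightarrow> bool"
  where "nil_clean_ring R \<longleftrightarrow> ring R \<and> (\<forall>a \<in> carrier R. \<exists>e t. nil_clean_decomp R a e t)"

definition uniquely_clean_ring :: "('a, 'm) ring_scheme \<Rightarrow> bool"
  where "uniquely_clean_ring R \<longleftrightarrow>
    ring R \<and> (\<forall>a \<in> carrier R. \<exists>!(e, t). clean_decomp R a e t)"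

definition uniquely_nil_clean_ring :: "('a, 'm) ring_scheme \<Rightarrow> bool"
  where "uniquely_nil_clean_ring R \<longleftrightarrow>
    ring R \<and> (\<forall>a \<in> carrier R. \<exists>!(e, t). nil_clean_decomp R a e t)"

definition conjugate_clean_ring :: "('a, 'm) ring_scheme \<Rightarrow> bool"
  where "conjugate_clean_ring R \<longleftrightarrow>
    clean_ring R \<and>
    (\<forall>a \<in> carrier R. \<forall>e s f t. clean_decomp R a e s \<longrightarrow> clean_decomp R a f t \<longrightarrow> ring_conjugate R e f)"

definition conjugate_nil_clean_ring :: "('a, 'm) ring_scheme \<Rightarrow> bool"
  where "conjugate_nil_clean_ring R \<longleftrightarrow>
    nil_clean_ring R \<and>
    (\<forall>a \<in> carrier R. \<forall>e s f t.
      nil_clean_decomp R a e s \<longrightarrow> nil_clean_decomp R a f t \<longrightarrow> ring_conjugate R e f)"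

end

theory Submission
  imports Defs
begin

text \<open>
  Conjugation fixes central elements, so in an abelian ring conjugate idempotents are equal.
  Hence over an abelian ring the conjugate and the unique versions of a decomposition property
  agree, whatever the second summands are required to be
  (\<open>unique_iff_conjugate_if_abelian\<close>).

  It remains to see why uniqueness forces the ring to be abelian. If an idempotent \<open>e\<close> fails to
  commute with some \<open>r\<close>, then one of the elements \<open>n = er(1 - e)\<close> and \<open>n = (1 - e)re\<close> is nonzero.
  Such an \<open>n\<close> squares to zero, and \<open>e + n\<close> is again idempotent
  (\<open>idempotent_add_corner\<close>). Now \<open>(e + n) + 0 = e + n\<close> shows two nil clean decompositions of one
  element, and \<open>(e + n) + 1 = e + (1 + n)\<close> two clean ones, since \<open>1 + n\<close> is invertible with
  inverse \<open>1 - n\<close>. Both decompositions being the same gives \<open>n = 0\<close>. The lemma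
  \<open>abelian_ringI\<close> isolates this common part.
\<close>

context ring
begin

lemma eq_if_minus_zero:
  assumes "x \<ominus> y = \<zero>" "x \<in> carrier R" "y \<in> carrier R"
  shows "x = y"
  using assms minus_equality[of x "\<ominus> y"] by (simp add: minus_eq)

lemma one_add_square_zero_Units:
  assumes n: "n \<in> carrier R" and nn: "n \<otimes> n = \<zero>"
  shows "\<one> \<oplus> n \<in> Units R"
proof -
  have "(\<one> \<oplus> n) \<otimes> (\<one> \<ominus> n) = \<one>" "(\<one> \<ominus> n) \<otimes> (\<one> \<oplus> n) = \<one>"
    using n by (simp_all add: minus_eq l_distr r_distr l_minus r_minus nn a_assoc l_neg r_neg)
  moreover have "\<one> \<oplus> n \<in> carrier R" "\<one> \<ominus> n \<in> carrier R"
    using n by simp_all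
  ultimately show ?thesis
    unfolding Units_def by blast
qed

text \<open>
  The hypothesis on \<open>n\<close> says that it lies in one of the two off-diagonal parts of the Peirce
  decomposition of the ring with respect to \<open>e\<close>; there \<open>e\<close> acts as the identity on one side and
  as zero on the other.
\<close>

lemma idempotent_add_corner:
  assumes e: "e \<in> idempotents R" and n: "n \<in> carrier R"
    and corner: "e \<otimes> n = n \<and> n \<otimes> e = \<zero> \<or> e \<otimes> n = \<zero> \<and> n \<otimes> e = n"
  shows "n \<otimes> n = \<zero>" and "e \<oplus> n \<in> idempotents R"
proof -
  have eR: "e \<in> carrier R" and ee: "e \<otimes> e = e"
    using e by (auto simp: idempotents_def)
  have "(n \<otimes> e) \<otimes> n = n \<otimes> (e \<otimes> n)"
    using eR n by (simp add: m_assoc)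
  with corner n show nn: "n \<otimes> n = \<zero>"
    by auto
  have "(e \<oplus> n) \<otimes> (e \<oplus> n) = e \<otimes> e \<oplus> (e \<otimes> n \<oplus> n \<otimes> e) \<oplus> n \<otimes> n"
    using eR n by algebra
  also have "\<dots> = e \<oplus> n"
    using corner eR n by (auto simp: ee nn)
  finally show "e \<oplus> n \<in> idempotents R"
    using eR n by (simp add: idempotents_def)
qed

text \<open>
  The two corner elements \<open>er - ere\<close> and \<open>re - ere\<close> measure the failure of \<open>e\<close> and \<open>r\<close> to
  commute: when both vanish, \<open>er = ere = re\<close>.
\<close>

lemma abelian_ringI:
  assumes rigid: "\<And>e n. \<lbrakk>e \<in> idempotents R; e \<oplus> n \<in> idempotents R; n \<in> carrier R; n \<otimes> n = \<zero>\<rbrakk>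
    \<Longrightarrow> n = \<zero>"
  shows "abelian_ring R"
proof -
  have "e \<otimes> r = r \<otimes> e" if e: "e \<in> idempotents R" and r: "r \<in> carrier R" for e r
  proof -
    have eR: "e \<in> carrier R" and ee: "e \<otimes> e = e"
      using e by (auto simp: idempotents_def)
    have eex: "e \<otimes> (e \<otimes> x) = e \<otimes> x" if "x \<in> carrier R" for x
      using that eR by (simp add: m_assoc[symmetric] ee)
    define n where "n = e \<otimes> r \<ominus> e \<otimes> r \<otimes> e"
    define m where "m = r \<otimes> e \<ominus> e \<otimes> r \<otimes> e"
    have nR: "n \<in> carrier R" and mR: "m \<in> carrier R"
      using eR r by (auto simp: n_def m_def)
    have n: "e \<otimes> n = n" "n \<otimes> e = \<zero>"
      using eR r
      by (simp_all add: n_def minus_eq r_distr l_distr r_minus l_minus m_assoc eex ee r_neg)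
    have m: "e \<otimes> m = \<zero>" "m \<otimes> e = m"
      using eR r
      by (simp_all add: m_def minus_eq r_distr l_distr r_minus l_minus m_assoc eex ee r_neg)
    have "x = \<zero>"
      if "x \<in> carrier R" and "e \<otimes> x = x \<and> x \<otimes> e = \<zero> \<or> e \<otimes> x = \<zero> \<and> x \<otimes> e = x" for x
      using idempotent_add_corner[OF e that] by (intro rigid[OF e _ that(1)])
    then have "n = \<zero>" "m = \<zero>"
      using n m nR mR by blast+
    then have "e \<otimes> r = e \<otimes> r \<otimes> e" "r \<otimes> e = e \<otimes> r \<otimes> e"
      using eR r by (auto simp: n_def m_def intro: eq_if_minus_zero)
    then show ?thesis
      by simp
  qed
  then show ?thesis
    by (auto simp: abelian_ring_def ring_center_def idempotents_def intro: ring_axioms)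
qed

lemma ring_conjugate_refl:
  assumes "e \<in> carrier R"
  shows "ring_conjugate R e e"
  unfolding ring_conjugate_def using assms by (auto intro!: bexI[of _ \<one>])

lemma ring_conjugate_central_eq:
  assumes "ring_conjugate R e f" and f: "f \<in> ring_center R"
  shows "e = f"
proof -
  obtain u where u: "u \<in> Units R" and e: "e = u \<otimes> f \<otimes> inv u"
    using assms(1) by (auto simp: ring_conjugate_def)
  have fR: "f \<in> carrier R" and "u \<otimes> f = f \<otimes> u"
    using f u by (auto simp: ring_center_def)
  with e have "e = f \<otimes> (u \<otimes> inv u)"
    using u fR by (simp add: m_assoc Units_closed)
  then show ?thesis
    using u fR by simp
qed

text \<open>
  The set \<open>T\<close> of admissible second summands stands for the units in the clean case and for the
  nilpotent elements in the nil clean case.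
\<close>

lemma unique_iff_conjugate_if_abelian:
  assumes "abelian_ring R" and T: "T \<subseteq> carrier R"
    and D: "\<And>a e t. D a e t \<longleftrightarrow> e \<in> idempotents R \<and> t \<in> T \<and> a = e \<oplus> t"
  shows "(\<forall>a \<in> carrier R. \<exists>!(e, t). D a e t) \<longleftrightarrow>
    (\<forall>a \<in> carrier R. \<exists>e t. D a e t) \<and>
    (\<forall>a \<in> carrier R. \<forall>e s f t. D a e s \<longrightarrow> D a f t \<longrightarrow> ring_conjugate R e f)"
    (is "?U \<longleftrightarrow> ?E \<and> ?C")
proof
  assume ?U
  have "ring_conjugate R e f" if "a \<in> carrier R" "D a e s" "D a f t" for a e s f t
  proof -
    have "(e, s) = (f, t)"
      using \<open>?U\<close> that by blast
    moreover have "e \<in> carrier R"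
      using that by (simp add: D idempotents_def)
    ultimately show ?thesis
      by (simp add: ring_conjugate_refl)
  qed
  with \<open>?U\<close> show "?E \<and> ?C"
    by blast
next
  assume EC: "?E \<and> ?C"
  have unique: "e = f \<and> s = t" if "a \<in> carrier R" "D a e s" "D a f t" for a e s f t
  proof -
    have "ring_conjugate R e f"
      using EC that by blast
    moreover have "f \<in> ring_center R"
      using that assms(1) by (auto simp: D abelian_ring_def)
    ultimately have "e = f"
      by (rule ring_conjugate_central_eq)
    moreover have "s \<in> carrier R" "t \<in> carrier R" "e \<in> carrier R" "e \<oplus> s = f \<oplus> t"
      using that T by (auto simp: D idempotents_def)
    ultimately show ?thesis
      by simp
  qed
  show ?U
  proof
    fix a
    assume a: "a \<in> carrier R"
    then obtain e t where "D a e t"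
      using EC by blast
    then show "\<exists>!(e, t). D a e t"
      using unique[OF a] by (intro ex1I[of _ "(e, t)"]) auto
  qed
qed

lemma uniquely_clean_imp_abelian:
  assumes "uniquely_clean_ring R"
  shows "abelian_ring R"
proof (rule abelian_ringI)
  fix e n
  assume e: "e \<in> idempotents R" and en: "e \<oplus> n \<in> idempotents R"
    and n: "n \<in> carrier R" "n \<otimes> n = \<zero>"
  have eR: "e \<in> carrier R"
    using e by (simp add: idempotents_def)
  let ?a = "e \<oplus> (\<one> \<oplus> n)"
  have "clean_decomp R ?a e (\<one> \<oplus> n)"
    using e n by (simp add: clean_decomp_def one_add_square_zero_Units)
  moreover have "clean_decomp R ?a (e \<oplus> n) \<one>"
    using en eR n by (simp add: clean_decomp_def a_ac)
  moreover have "?a \<in> carrier R"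
    using eR n by simp
  ultimately have "(e, \<one> \<oplus> n) = (e \<oplus> n, \<one>)"
    using assms unfolding uniquely_clean_ring_def by blast
  then show "n = \<zero>"
    using eR n by simp
qed

lemma uniquely_nil_clean_imp_abelian:
  assumes "uniquely_nil_clean_ring R"
  shows "abelian_ring R"
proof (rule abelian_ringI)
  fix e n
  assume e: "e \<in> idempotents R" and en: "e \<oplus> n \<in> idempotents R"
    and n: "n \<in> carrier R" "n \<otimes> n = \<zero>"
  have eR: "e \<in> carrier R"
    using e by (simp add: idempotents_def)
  have "n [^] (2::nat) = \<zero>" "\<zero> [^] Suc 0 = \<zero>"
    using n by (simp_all add: numeral_2_eq_2)
  then have "n \<in> nilpotents R" "\<zero> \<in> nilpotents R"
    using n(1) unfolding nilpotents_def by blast+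
  then have "nil_clean_decomp R (e \<oplus> n) e n" "nil_clean_decomp R (e \<oplus> n) (e \<oplus> n) \<zero>"
    using e en eR n by (simp_all add: nil_clean_decomp_def)
  moreover have "e \<oplus> n \<in> carrier R"
    using eR n by simp
  ultimately have "(e, n) = (e \<oplus> n, \<zero>)"
    using assms unfolding uniquely_nil_clean_ring_def by blast
  then show "n = \<zero>"
    by simp
qed

end

theorem mainTheorem2:
  fixes R :: "('a, 'm) ring_scheme"
  assumes "ring R"
  shows "(uniquely_clean_ring R \<longleftrightarrow> conjugate_clean_ring R \<and> abelian_ring R)
       \<and> (uniquely_nil_clean_ring R \<longleftrightarrow> conjugate_nil_clean_ring R \<and> abelian_ring R)"
proof -
  interpret ring R
    by fact
  have Units_subset: "Units R \<subseteq> carrier R"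
    and nilpotents_subset: "nilpotents R \<subseteq> carrier R"
    by (auto simp: nilpotents_def)
  have "uniquely_clean_ring R \<longleftrightarrow> conjugate_clean_ring R" if "abelian_ring R"
    unfolding uniquely_clean_ring_def conjugate_clean_ring_def clean_ring_def
    using unique_iff_conjugate_if_abelian[OF that Units_subset clean_decomp_def] assms
    by simp
  moreover have "uniquely_nil_clean_ring R \<longleftrightarrow> conjugate_nil_clean_ring R" if "abelian_ring R"
    unfolding uniquely_nil_clean_ring_def conjugate_nil_clean_ring_def nil_clean_ring_def
    using unique_iff_conjugate_if_abelian[OF that nilpotents_subset nil_clean_decomp_def] assms
    by simp
  ultimately show ?thesis
    using uniquely_clean_imp_abelian uniquely_nil_clean_imp_abelian by blast
qed

end
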